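(* Consider the unicycle with state $q=(x_c,y_c,\theta)'$ in closed loop with the feedback below with $\rho=-1$, i.e. $$\begin{bmatrix}\dot x_c\\ \dot y_c\end{bmatrix}=-\begin{bmatrix}\cos\theta\\ \sin\theta\end{bmatrix}\bigl(\cos(\theta)\,x_c+\sin(\theta)\,y_c\bigr),\qquad \dot\theta=-\theta,$$ with $\theta(0)=\theta_0$. Put $X=(x_c,y_c)'$ and define $Z=(z_1,z_2)'$ by $X(t)=R(\theta(t))\,Z(t)$. Then the trajectories are given in closed form by $$\theta(t)=\theta_0e^{-t},\qquad z_1(t)=\theta(t)\,\bigl[C_1J_0(\theta(t))+C_2Y_0(\theta(t))\bigr],\qquad z_2(t)=\frac{\dot z_1(t)+z_1(t)}{\dot\theta(t)},$$ where $C_1,C_2$ are arbitrary constants depending on the initial conditions.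
   Context: The unicycle kinematic model is $\dot x_c=u_1\cos\theta$, $\dot y_c=u_1\sin\theta$, $\dot\theta=u_2$, where $(x_c,y_c)$ is the position of the wheel baseline center and $\theta$ the attitude. The feedback is $u_1=\rho\,(x_c\cos\theta+y_c\sin\theta)$, $u_2=\rho\,\theta$. $R(\theta)=\begin{bmatrix}\cos\theta&-\sin\theta\\ \sin\theta&\cos\theta\end{bmatrix}$ is the rotation matrix. $J_0$ and $Y_0$ are the Bessel functions of order $0$ of the first and second kind.
   Formalization: The initial attitude is assumed nonzero, since for θ_0=0 the closed form is undefined (Y_0(0), division by zero); the constants C_1, C_2 range over those making z_1 real, which for θ_0<0 allows complex C_1 because Y_0 is complex there. *)

theory Defs
  imports "HOL-Analysis.Analysis"
begin

definition unicycle ::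
    "(real \<Rightarrow> real) \<Rightarrow> (real \<Rightarrow> real) \<Rightarrow> (real \<Rightarrow> real^2) \<Rightarrow> (real \<Rightarrow> real) \<Rightarrow> bool" where
  "unicycle u1 u2 X \<theta> \<longleftrightarrow>
     (\<forall>t\<ge>0. (X has_vector_derivative u1 t *\<^sub>R vector [cos (\<theta> t), sin (\<theta> t)]) (at t within {0..})
           \<and> (\<theta> has_real_derivative u2 t) (at t within {0..}))"

definition feedback1 :: "real \<Rightarrow> real^2 \<Rightarrow> real \<Rightarrow> real" where
  "feedback1 \<rho> p \<phi> = \<rho> * (p $ 1 * cos \<phi> + p $ 2 * sin \<phi>)"

definition feedback2 :: "real \<Rightarrow> real^2 \<Rightarrow> real \<Rightarrow> real" where
  "feedback2 \<rho> p \<phi> = \<rho> * \<phi>"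

definition closed_loop :: "real \<Rightarrow> (real \<Rightarrow> real^2) \<Rightarrow> (real \<Rightarrow> real) \<Rightarrow> bool" where
  "closed_loop \<rho> X \<theta> \<longleftrightarrow>
     unicycle (\<lambda>t. feedback1 \<rho> (X t) (\<theta> t)) (\<lambda>t. feedback2 \<rho> (X t) (\<theta> t)) X \<theta>"

definition rotation :: "real \<Rightarrow> real^2^2" where
  "rotation \<phi> = vector [vector [cos \<phi>, - sin \<phi>], vector [sin \<phi>, cos \<phi>]]"

definition bessel_J0 :: "complex \<Rightarrow> complex" where
  "bessel_J0 z = (\<Sum>k. (-1) ^ k / (fact k)\<^sup>2 * (z / 2) ^ (2 * k))"

(* The standard series of Y_0 (DLMF 10.8.2; harm 0 = 0). Ln is the principal branch,
   so that on the negative axis Y_0(-r) = Y_0(r) + 2 i J_0(r) for r > 0. *)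
definition bessel_Y0 :: "complex \<Rightarrow> complex" where
  "bessel_Y0 z =
     2 / of_real pi * (Ln (z / 2) + euler_mascheroni) * bessel_J0 z
     - 2 / of_real pi * (\<Sum>k. (-1) ^ k * harm k / (fact k)\<^sup>2 * (z / 2) ^ (2 * k))"

(* The constants for which C1 J_0 + C2 Y_0 is real on the half-axis containing \<theta>0:
   real constants when \<theta>0 > 0; for \<theta>0 < 0 the imaginary part of the principal branch
   of Y_0 has to be compensated by C1. *)
definition admissible_constants :: "real \<Rightarrow> complex \<Rightarrow> complex \<Rightarrow> bool" where
  "admissible_constants \<theta>0 C1 C2 \<longleftrightarrow>
     (if \<theta>0 > 0 then C1 \<in> \<real> \<and> C2 \<in> \<real> else C1 + 2 * \<i> * C2 \<in> \<real> \<and> C2 \<in> \<real>)"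

definition closed_form ::
    "real \<Rightarrow> complex \<Rightarrow> complex \<Rightarrow> (real \<Rightarrow> real) \<Rightarrow> (real \<Rightarrow> real^2) \<Rightarrow> bool" where
  "closed_form \<theta>0 C1 C2 \<theta> Z \<longleftrightarrow>
     (\<forall>t\<ge>0. \<theta> t = \<theta>0 * exp (- t)
        \<and> of_real (Z t $ 1) =
            of_real (\<theta> t) * (C1 * bessel_J0 (of_real (\<theta> t)) + C2 * bessel_Y0 (of_real (\<theta> t)))
        \<and> (\<exists>z1' \<theta>'. ((\<lambda>s. Z s $ 1) has_real_derivative z1') (at t within {0..})
              \<and> (\<theta> has_real_derivative \<theta>') (at t within {0..})
              \<and> Z t $ 2 = (z1' + Z t $ 1) / \<theta>'))"

end

(* In the rotated coordinates the closed loop reads z1' = - z1 - \<theta> z2, z2' = \<theta> z1 with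
   \<theta>' = - \<theta>.  Taking \<theta> as independent variable and z1 = \<theta> w turns this into z2 = \<theta> dw/d\<theta>
   and Bessel's equation of order 0 for w.  Since Y_0 is real up to a multiple of J_0 on either
   half-axis, admissible constants correspond to real combinations of two real solutions.  Their
   Wronskian does not vanish, so every initial value is attained, and the norm of the difference
   of two solutions cannot grow, so solutions are unique. *)

theory Submission imports Defs begin

subsection \<open>The Bessel functions on the real axis\<close>

definition cA :: "nat \<Rightarrow> real" where
  "cA k = (-1) ^ k / (fact k)\<^sup>2"

definition cH :: "nat \<Rightarrow> real" where
  "cH k = (-1) ^ k * harm k / (fact k)\<^sup>2"

definition pseries :: "(nat \<Rightarrow> real) \<Rightarrow> real \<Rightarrow> real" where
  "pseries c u = (\<Sum>k. c k * u ^ k)"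

text \<open>Comparison with the exponential series. Convergence at every u makes termwise
  differentiation available on the whole line.\<close>

lemma summable_power_fact_bound:
  fixes c :: "nat \<Rightarrow> real"
  assumes "\<And>k. \<bar>c k\<bar> \<le> 1 / fact k"
  shows "summable (\<lambda>k. c k * u ^ k)"
proof (rule summable_comparison_test)
  show "\<exists>N. \<forall>n\<ge>N. norm (c n * u ^ n) \<le> \<bar>u\<bar> ^ n /\<^sub>R fact n"
    using mult_right_mono[OF assms, of "\<bar>u\<bar> ^ k" k for k]
    by (auto simp: abs_mult power_abs divide_inverse mult.commute)
  show "summable (\<lambda>n. \<bar>u\<bar> ^ n /\<^sub>R fact n)"
    by (rule summable_exp_generic)
qed

text \<open>A crude bound, but enough for the harmonic number in \<open>cH\<close> to be absorbed by
  one of its two factorials.\<close>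

lemma harm_le_self: "harm n \<le> real n"
proof (induction n)
  case (Suc n)
  have "inverse (real (Suc n)) \<le> 1"
    by (simp add: field_simps)
  with Suc show ?case
    by (simp add: harm_Suc)
qed (simp add: harm_def)

lemma summable_cA: "summable (\<lambda>k. cA k * u ^ k)"
proof (rule summable_power_fact_bound)
  fix k
  have "(1::real) \<le> fact k" by (rule fact_ge_1)
  then show "\<bar>cA k\<bar> \<le> 1 / fact k"
    by (simp add: cA_def power2_eq_square power_abs field_simps)
qed

lemma summable_cH: "summable (\<lambda>k. cH k * u ^ k)"
proof (rule summable_power_fact_bound)
  fix k
  have "harm k \<le> real k" by (rule harm_le_self)
  also have "\<dots> \<le> real (fact k)"
    using fact_ge_self[of k] by (simp only: of_nat_le_iff)
  finally have "harm k \<le> (fact k :: real)" by simp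
  then show "\<bar>cH k\<bar> \<le> 1 / fact k"
    using harm_nonneg[of k, where 'a=real]
    by (simp add: cH_def power2_eq_square power_abs abs_mult field_simps)
qed

lemma pseries_deriv:
  assumes "\<And>y. summable (\<lambda>k. c k * y ^ k)"
  shows "(pseries c has_real_derivative pseries (diffs c) u) (at u)"
  using termdiffs_strong_converges_everywhere[OF assms] by (simp add: pseries_def[abs_def])

lemma summable_diffs:
  fixes c :: "nat \<Rightarrow> real"
  assumes "\<And>y. summable (\<lambda>k. c k * y ^ k)"
  shows "summable (\<lambda>k. diffs c k * u ^ k)"
  by (rule termdiff_converges[of u "\<bar>u\<bar> + 1"]) (use assms in auto)

text \<open>The operator u d/du multiplies the k-th coefficient by k; one more derivative gives a
  second factor k and shifts the index. Since x d/dx = 2 u d/du, the resulting (u f')' is the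
  leading part of Bessel's equation in the variable u.\<close>

lemma pseries_euler_deriv:
  assumes c: "\<And>y. summable (\<lambda>k. c k * y ^ k)"
  shows "((\<lambda>u. u * pseries (diffs c) u) has_real_derivative
           pseries (\<lambda>k. real (Suc k) ^ 2 * c (Suc k)) u) (at u)"
proof -
  define e where "e = (\<lambda>k. real k * c k)"
  have s: "(\<lambda>k. e k * y ^ k) sums (y * pseries (diffs c) y)" for y
  proof -
    have "(\<lambda>k. diffs c k * y ^ k) sums pseries (diffs c) y"
      unfolding pseries_def using summable_diffs[OF c] by (rule summable_sums)
    then have "(\<lambda>k. y * (diffs c k * y ^ k)) sums (y * pseries (diffs c) y)"
      by (rule sums_mult)
    moreover have "y * (diffs c k * y ^ k) = e (Suc k) * y ^ Suc k" for k
      by (simp add: e_def diffs_def algebra_simps)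
    ultimately have "(\<lambda>k. e (Suc k) * y ^ Suc k) sums (y * pseries (diffs c) y)"
      by simp
    \<comment> \<open>The index can be shifted without a correction term because
      \<open>e 0 = 0\<close>.\<close>
    then show ?thesis
      using sums_Suc_iff[of "\<lambda>k. e k * y ^ k" "y * pseries (diffs c) y"] by (simp add: e_def)
  qed
  have "(\<lambda>u. u * pseries (diffs c) u) = pseries e"
    using sums_unique[OF s] by (simp add: pseries_def fun_eq_iff)
  moreover have "diffs e = (\<lambda>k. real (Suc k) ^ 2 * c (Suc k))"
    by (simp add: diffs_def e_def power2_eq_square fun_eq_iff)
  ultimately show ?thesis
    using pseries_deriv[of e u] s sums_summable by metis
qed

section \<open>Coefficient recurrences, differential equations and Wronskian of the two
  series\<close>

lemma cA_recurrence: "real (Suc k) ^ 2 * cA (Suc k) = - cA k"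
proof -
  have "fact (Suc k) = real (Suc k) * fact k" by simp
  then show ?thesis
    unfolding cA_def power_mult_distrib by (simp add: power_mult_distrib del: fact_Suc)
qed

text \<open>Splitting harm (k+1) = harm k + 1 / (k+1) yields the recurrence of \<open>cA\<close>
  plus a source term, which another use of \<open>cA_recurrence\<close> identifies as a coefficient
  of \<open>serA'\<close>.\<close>

lemma cH_recurrence: "real (Suc k) ^ 2 * cH (Suc k) = diffs cA k - cH k"
proof -
  have c: "cH j = cA j * harm j" for j
    by (simp add: cH_def cA_def)
  have "real (Suc k) ^ 2 * cH (Suc k) = (real (Suc k) ^ 2 * cA (Suc k)) * harm (Suc k)"
    unfolding c by (rule mult.assoc[symmetric])
  also have "\<dots> = - cA k * harm (Suc k)"
    by (simp only: cA_recurrence)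
  also have "\<dots> = - cH k - cA k / real (Suc k)"
    unfolding c[of k] harm_Suc by (simp add: algebra_simps divide_inverse)
  also have "- cH k - cA k / real (Suc k) = - cH k + diffs cA k"
    using cA_recurrence[of k] by (simp add: diffs_def power2_eq_square field_simps)
  finally show ?thesis by simp
qed

text \<open>With \<open>u = x\<^sup>2 / 4\<close>, \<open>serA u\<close> is \<open>J\<^sub>0 x\<close> and \<open>serH u\<close> is the harmonic-number series in \<open>Y\<^sub>0 x\<close>.
  Bessel's equation becomes \<open>(u serA')' = - serA\<close>.\<close>

abbreviation "serA \<equiv> pseries cA"
abbreviation "serA' \<equiv> pseries (diffs cA)"
abbreviation "serH \<equiv> pseries cH"
abbreviation "serH' \<equiv> pseries (diffs cH)"

lemmas serA_deriv = pseries_deriv[OF summable_cA]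
lemmas serH_deriv = pseries_deriv[OF summable_cH]

lemma serA_euler:
  "((\<lambda>u. u * serA' u) has_real_derivative - serA u) (at u)"
proof -
  have "pseries (\<lambda>k. - cA k) u = - serA u"
    using suminf_minus[OF summable_cA[of u]] by (simp add: pseries_def)
  with pseries_euler_deriv[OF summable_cA, of u] show ?thesis
    unfolding cA_recurrence by (simp only:)
qed

text \<open>The source term \<open>serA'\<close> is what later cancels the contributions of the
  differentiated logarithm in \<open>rdY_deriv\<close>.\<close>

lemma serH_euler:
  "((\<lambda>u. u * serH' u) has_real_derivative serA' u - serH u) (at u)"
proof -
  have "pseries (\<lambda>k. diffs cA k - cH k) u = serA' u - serH u"
    using suminf_diff[OF summable_diffs[OF summable_cA, of u] summable_cH[of u]]
    by (simp add: pseries_def left_diff_distrib)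
  with pseries_euler_deriv[OF summable_cH, of u] show ?thesis
    unfolding cH_recurrence by (simp only:)
qed

lemma serA_0: "serA 0 = 1"
  unfolding pseries_def powser_zero by (simp add: cA_def)

text \<open>Up to the factor 2 / pi this is the Wronskian of \<open>rJ\<close> and \<open>rY\<close>
  after the logarithms have cancelled. The two Euler equations make its derivative vanish, and its
  constant value is read off at u = 0, where the factors u leave only
  \<open>serA 0 ^ 2\<close>.\<close>

lemma wronskian_series:
  "serA u ^ 2 - 2 * (serA u * (u * serH' u) - (u * serA' u) * serH u) = 1"
proof -
  let ?W = "\<lambda>u. serA u ^ 2 - 2 * (serA u * (u * serH' u) - (u * serA' u) * serH u)"
  have "(?W has_real_derivative 0) (at x)" for x
    by (rule derivative_eq_intros serA_deriv serH_deriv serA_euler serH_euler refl)+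
      (simp add: algebra_simps)
  then have "?W u = ?W 0"
    using DERIV_isconst_all by blast
  then show ?thesis by (simp add: serA_0)
qed

section \<open>Real forms of J_0 and Y_0, Bessel's equation for them and their Wronskian\<close>

definition rJ :: "real \<Rightarrow> real" where
  "rJ x = serA (x\<^sup>2 / 4)"

definition rY :: "real \<Rightarrow> real" where
  "rY x = 2 / pi * ((ln (\<bar>x\<bar> / 2) + euler_mascheroni) * rJ x - serH (x\<^sup>2 / 4))"

text \<open>On the negative axis \<open>rY\<close> is the even continuation of \<open>Y\<^sub>0\<close>, not its principal branch.
  \<open>rdJ x = x * J\<^sub>0' x\<close> and \<open>rdY x = x * rY' x\<close>.\<close>

definition rdJ :: "real \<Rightarrow> real" where
  "rdJ x = 2 * (x\<^sup>2 / 4 * serA' (x\<^sup>2 / 4))"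

definition rdY :: "real \<Rightarrow> real" where
  "rdY x = 2 / pi * (rJ x + (ln (\<bar>x\<bar> / 2) + euler_mascheroni) * rdJ x
             - 2 * (x\<^sup>2 / 4 * serH' (x\<^sup>2 / 4)))"

lemma square_quarter_deriv: "((\<lambda>x. x\<^sup>2 / 4) has_real_derivative x / 2) (at x)"
  by (auto intro!: derivative_eq_intros)

lemma rJ_deriv: "x \<noteq> 0 \<Longrightarrow> (rJ has_real_derivative rdJ x / x) (at x)"
  unfolding rJ_def[abs_def]
  by (rule DERIV_cong[OF DERIV_chain2[OF serA_deriv square_quarter_deriv]])
    (simp add: rdJ_def power2_eq_square)

text \<open>The chain rule turns \<open>serA_euler\<close> into Bessel's equation in self-adjoint
  form, (x w')' = - x w.\<close>

lemma rdJ_deriv: "(rdJ has_real_derivative - x * rJ x) (at x)"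
  unfolding rdJ_def[abs_def]
  by (rule DERIV_cong[OF DERIV_cmult[OF DERIV_chain2[OF serA_euler square_quarter_deriv]]])
    (simp add: rJ_def)

lemma ln_abs_half_deriv:
  assumes "x \<noteq> 0"
  shows "((\<lambda>x::real. ln (\<bar>x\<bar> / 2)) has_real_derivative 1 / x) (at x)"
proof -
  have "((\<lambda>x::real. ln \<bar>x\<bar>) has_real_derivative 1 / x) (at x)"
  proof (cases "x > 0")
    case True
    show ?thesis
      by (rule has_field_derivative_transform_within_open[where f = ln and S = "{0<..}"])
        (use True in \<open>auto intro!: derivative_eq_intros\<close>)
  next
    case False
    show ?thesis
      by (rule has_field_derivative_transform_within_open[where f = "\<lambda>x. ln (- x)" and S = "{..<0}"])
        (use False assms in \<open>auto intro!: derivative_eq_intros\<close>)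
  qed
  then have "((\<lambda>x::real. ln \<bar>x\<bar> - ln 2) has_real_derivative 1 / x) (at x)"
    using DERIV_diff[OF _ DERIV_const, of "\<lambda>x. ln \<bar>x\<bar>" "1 / x" x UNIV "ln 2"] by simp
  then show ?thesis
    by (rule has_field_derivative_transform_within_open[where S = "- {0}"])
      (use assms in \<open>auto simp: ln_div\<close>)
qed

lemma rY_deriv:
  assumes "x \<noteq> 0"
  shows "(rY has_real_derivative rdY x / x) (at x)"
proof -
  note h = DERIV_chain2[OF serH_deriv square_quarter_deriv]
  show ?thesis
    unfolding rY_def[abs_def]
    by (rule derivative_eq_intros rJ_deriv ln_abs_half_deriv h assms refl)+
      (use assms in \<open>simp add: rdY_def field_simps power2_eq_square\<close>)
qed

text \<open>Differentiating \<open>rJ\<close> and the logarithm produces \<open>rdJ x / x\<close>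
  twice, together x times \<open>serA'\<close>; the source term in \<open>serH_euler\<close> removes
  exactly this, and the same self-adjoint equation as for \<open>rdJ\<close> remains.\<close>

lemma rdY_deriv:
  assumes "x \<noteq> 0"
  shows "(rdY has_real_derivative - x * rY x) (at x)"
proof -
  note h = DERIV_chain2[OF serH_euler square_quarter_deriv]
  show ?thesis
    unfolding rdY_def[abs_def]
    by (rule derivative_eq_intros rJ_deriv rdJ_deriv ln_abs_half_deriv h assms refl)+
      (use assms in \<open>simp add: rY_def rdJ_def field_simps power2_eq_square\<close>)
qed

text \<open>The two products containing the logarithm cancel, so the identity reduces to
  \<open>wronskian_series\<close> and holds at x = 0 as well, whatever the value of
  \<open>ln 0\<close>.\<close>

lemma wronskian_real: "rJ x * rdY x - rdJ x * rY x = 2 / pi"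
proof -
  have "rJ x * rdY x - rdJ x * rY x = 2 / pi * (serA (x\<^sup>2/4) ^ 2
    - 2 * (serA (x\<^sup>2/4) * (x\<^sup>2/4 * serH' (x\<^sup>2/4)) - (x\<^sup>2/4 * serA' (x\<^sup>2/4)) * serH (x\<^sup>2/4)))"
    unfolding rdY_def rY_def rdJ_def rJ_def by (simp add: field_simps power2_eq_square)
  then show ?thesis unfolding wronskian_series by simp
qed

section \<open>Restriction of the complex Bessel functions to the real axis\<close>

lemma bessel_J0_of_real: "bessel_J0 (of_real x) = of_real (rJ x)"
proof -
  have "of_real (rJ x) = (\<Sum>k. of_real (cA k * (x\<^sup>2 / 4) ^ k) :: complex)"
    unfolding rJ_def pseries_def by (rule suminf_of_real[OF summable_cA])
  also have "\<dots> = bessel_J0 (of_real x)"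
    unfolding bessel_J0_def
    by (simp add: cA_def power_mult power_divide)
  finally show ?thesis ..
qed

text \<open>For negative x the principal logarithm adds i pi, which the prefactor 2 / pi turns into
  2 i times J_0.\<close>

lemma bessel_Y0_of_real:
  assumes "x \<noteq> 0"
  shows "bessel_Y0 (of_real x) = of_real (rY x) + (if x < 0 then 2 * \<i> * of_real (rJ x) else 0)"
proof -
  have "of_real (serH (x\<^sup>2 / 4)) = (\<Sum>k. of_real (cH k * (x\<^sup>2 / 4) ^ k) :: complex)"
    unfolding pseries_def by (rule suminf_of_real[OF summable_cH])
  also have "\<dots> = (\<Sum>k. (-1) ^ k * harm k / (fact k)\<^sup>2 * (of_real x / 2) ^ (2 * k))"
    by (simp add: cH_def power_mult power_divide of_real_harm)
  finally have H: "(\<Sum>k. (-1) ^ k * harm k / (fact k)\<^sup>2 * (complex_of_real x / 2) ^ (2 * k))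
      = of_real (serH (x\<^sup>2 / 4))" ..
  have L: "Ln (of_real x / 2) = of_real (ln (\<bar>x\<bar> / 2)) + (if x < 0 then pi else 0) * \<i>"
    using Ln_of_real'[of "x / 2"] assms by simp
  show ?thesis
    unfolding bessel_Y0_def H bessel_J0_of_real L rY_def
    by (simp add: field_simps)
qed

text \<open>The branch term is a multiple of J_0, so it only changes the first coefficient; the
  corrected \<open>c1\<close> is the number that \<open>admissible_constants\<close> requires to be
  real.\<close>

lemma bessel_combination_of_real:
  assumes "x \<noteq> 0" "c1 = (if x > 0 then C1 else C1 + 2 * \<i> * C2)"
  shows "C1 * bessel_J0 (of_real x) + C2 * bessel_Y0 (of_real x) = c1 * of_real (rJ x) + C2 * of_real (rY x)"
  using assms by (auto simp: bessel_J0_of_real bessel_Y0_of_real algebra_simps)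

subsection \<open>The closed loop in rotating coordinates\<close>

definition rotated_system :: "(real \<Rightarrow> real) \<Rightarrow> (real \<Rightarrow> real) \<Rightarrow> (real \<Rightarrow> real) \<Rightarrow> bool" where
  "rotated_system \<theta> z1 z2 \<longleftrightarrow>
     (\<forall>t\<ge>0. (\<theta> has_real_derivative - \<theta> t) (at t within {0..})
        \<and> (z1 has_real_derivative - z1 t - \<theta> t * z2 t) (at t within {0..})
        \<and> (z2 has_real_derivative \<theta> t * z1 t) (at t within {0..}))"

lemma has_vector_derivative_real2_iff:
  fixes X :: "real \<Rightarrow> real^2"
  shows "(X has_vector_derivative D) (at t within S) \<longleftrightarrow>
     ((\<lambda>t. X t $ 1) has_real_derivative D $ 1) (at t within S) \<and>
     ((\<lambda>t. X t $ 2) has_real_derivative D $ 2) (at t within S)"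
proof -
  have "(X has_vector_derivative D) (at t within S) \<longleftrightarrow>
     (\<forall>i. ((\<lambda>t. X t $ i) has_vector_derivative D $ i) (at t within S))"
    unfolding has_vector_derivative_def
    by (subst has_derivative_componentwise_within)
      (auto simp: Basis_vec_def inner_axis)
  then show ?thesis
    by (simp add: forall_2 has_real_derivative_iff_has_vector_derivative)
qed

lemma rotation_mult_vec:
  "(rotation \<phi> *v z) $ 1 = cos \<phi> * z $ 1 - sin \<phi> * z $ 2"
  "(rotation \<phi> *v z) $ 2 = sin \<phi> * z $ 1 + cos \<phi> * z $ 2"
  by (simp_all add: rotation_def matrix_vector_mult_def sum_2)

lemma rotation_inverse:
  "rotation \<phi> *v (rotation (- \<phi>) *v x) = x"
  "rotation (- \<phi>) *v (rotation \<phi> *v x) = x"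
proof -
  have *: "c * (c * a + s * b) - s * (c * b - s * a) = a"
    "s * (c * a + s * b) + c * (c * b - s * a) = b"
    if "s\<^sup>2 + c\<^sup>2 = 1" for s c a b :: real
    using that by algebra+
  show "rotation \<phi> *v (rotation (- \<phi>) *v x) = x"
    using *[OF sin_cos_squared_add[of \<phi>], of "x$1" "x$2"]
    by (simp add: vec_eq_iff forall_2 rotation_mult_vec)
  show "rotation (- \<phi>) *v (rotation \<phi> *v x) = x"
    using *[of "- sin \<phi>" "cos \<phi>" "x$1" "x$2"]
    by (simp add: vec_eq_iff forall_2 rotation_mult_vec algebra_simps)
qed

lemma closed_loop_iff:
  "closed_loop (-1) X \<theta> \<longleftrightarrow>
    (\<forall>t\<ge>0. (\<theta> has_real_derivative - \<theta> t) (at t within {0..}) \<and>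
      ((\<lambda>t. X t $ 1) has_real_derivative - (X t $ 1 * cos (\<theta> t) + X t $ 2 * sin (\<theta> t)) * cos (\<theta> t)) (at t within {0..}) \<and>
      ((\<lambda>t. X t $ 2) has_real_derivative - (X t $ 1 * cos (\<theta> t) + X t $ 2 * sin (\<theta> t)) * sin (\<theta> t)) (at t within {0..}))"
  unfolding closed_loop_def unicycle_def feedback1_def feedback2_def has_vector_derivative_real2_iff
  by auto

text \<open>Trajectories are constrained only for t >= 0, so functions may be exchanged only on this
  half-line, and derivatives are one-sided at 0.\<close>

lemma real_derivative_cong_atLeast:
  fixes f g :: "real \<Rightarrow> real"
  assumes "(f has_real_derivative d) (at t within {0..})" "\<And>r. r \<ge> 0 \<Longrightarrow> g r = f r" "t \<ge> 0"
  shows "(g has_real_derivative d) (at t within {0..})"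
  by (rule has_field_derivative_transform_within[OF assms(1) zero_less_one]) (use assms in auto)

text \<open>The feedback acts along the heading with strength - z1, because the first rotated
  coordinate is x cos \<theta> + y sin \<theta>. In the rotating frame it contributes (- z1, 0), and
  the turning of the frame contributes \<theta>' (z2, - z1) with \<theta>' = - \<theta>.\<close>

lemma closed_loop_iff_rotated_system:
  assumes X: "\<forall>t\<ge>0. X t = rotation (\<theta> t) *v Z t"
  shows "closed_loop (-1) X \<theta> \<longleftrightarrow> rotated_system \<theta> (\<lambda>t. Z t $ 1) (\<lambda>t. Z t $ 2)"
proof
  assume cl: "closed_loop (-1) X \<theta>"
  show "rotated_system \<theta> (\<lambda>t. Z t $ 1) (\<lambda>t. Z t $ 2)"
    unfolding rotated_system_def
  proof (intro allI impI)
    fix t :: real assume t: "t \<ge> 0"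
    let ?F = "at t within {0..}"
    let ?c = "cos (\<theta> t)" and ?s = "sin (\<theta> t)" and ?x = "X t $ 1" and ?y = "X t $ 2"
    have th: "(\<theta> has_real_derivative - \<theta> t) ?F"
      and x1: "((\<lambda>t. X t $ 1) has_real_derivative - (?x * ?c + ?y * ?s) * ?c) ?F"
      and x2: "((\<lambda>t. X t $ 2) has_real_derivative - (?x * ?c + ?y * ?s) * ?s) ?F"
      using cl t unfolding closed_loop_iff by auto
    have Z: "Z r = rotation (- \<theta> r) *v X r" if "r \<ge> 0" for r
      using X that by (simp add: rotation_inverse)
    have Z1: "Z r $ 1 = X r $ 1 * cos (\<theta> r) + X r $ 2 * sin (\<theta> r)"
      and Z2: "Z r $ 2 = X r $ 2 * cos (\<theta> r) - X r $ 1 * sin (\<theta> r)" if "r \<ge> 0" for r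
      using that by (simp_all add: Z rotation_mult_vec)
    have 1: "((\<lambda>r. X r $ 1 * cos (\<theta> r) + X r $ 2 * sin (\<theta> r)) has_real_derivative
        - Z t $ 1 - \<theta> t * Z t $ 2) ?F"
      by (rule derivative_eq_intros th x1 x2 refl)+
        (insert sin_cos_squared_add[of "\<theta> t"] Z1[OF t] Z2[OF t], algebra)
    have 2: "((\<lambda>r. X r $ 2 * cos (\<theta> r) - X r $ 1 * sin (\<theta> r)) has_real_derivative
        \<theta> t * Z t $ 1) ?F"
      by (rule derivative_eq_intros th x1 x2 refl)+
        (insert sin_cos_squared_add[of "\<theta> t"] Z1[OF t] Z2[OF t], algebra)
    show "(\<theta> has_real_derivative - \<theta> t) ?F \<and>
        ((\<lambda>t. Z t $ 1) has_real_derivative - Z t $ 1 - \<theta> t * Z t $ 2) ?F \<and>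
        ((\<lambda>t. Z t $ 2) has_real_derivative \<theta> t * Z t $ 1) ?F"
      using th real_derivative_cong_atLeast[OF 1 _ t] real_derivative_cong_atLeast[OF 2 _ t] Z1 Z2
      by simp
  qed
next
  assume rs: "rotated_system \<theta> (\<lambda>t. Z t $ 1) (\<lambda>t. Z t $ 2)"
  show "closed_loop (-1) X \<theta>"
    unfolding closed_loop_iff
  proof (intro allI impI)
    fix t :: real assume t: "t \<ge> 0"
    let ?F = "at t within {0..}"
    let ?c = "cos (\<theta> t)" and ?s = "sin (\<theta> t)" and ?x = "X t $ 1" and ?y = "X t $ 2"
    have th: "(\<theta> has_real_derivative - \<theta> t) ?F"
      and z1: "((\<lambda>t. Z t $ 1) has_real_derivative - Z t $ 1 - \<theta> t * Z t $ 2) ?F"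
      and z2: "((\<lambda>t. Z t $ 2) has_real_derivative \<theta> t * Z t $ 1) ?F"
      using rs t unfolding rotated_system_def by auto
    have X1: "X r $ 1 = cos (\<theta> r) * Z r $ 1 - sin (\<theta> r) * Z r $ 2"
      and X2: "X r $ 2 = sin (\<theta> r) * Z r $ 1 + cos (\<theta> r) * Z r $ 2" if "r \<ge> 0" for r
      using that X by (simp_all add: rotation_mult_vec)
    have 1: "((\<lambda>r. cos (\<theta> r) * Z r $ 1 - sin (\<theta> r) * Z r $ 2) has_real_derivative
        - (?x * ?c + ?y * ?s) * ?c) ?F"
      by (rule derivative_eq_intros th z1 z2 refl)+
        (insert sin_cos_squared_add[of "\<theta> t"] X1[OF t] X2[OF t], algebra)
    have 2: "((\<lambda>r. sin (\<theta> r) * Z r $ 1 + cos (\<theta> r) * Z r $ 2) has_real_derivative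
        - (?x * ?c + ?y * ?s) * ?s) ?F"
      by (rule derivative_eq_intros th z1 z2 refl)+
        (insert sin_cos_squared_add[of "\<theta> t"] X1[OF t] X2[OF t], algebra)
    show "(\<theta> has_real_derivative - \<theta> t) ?F \<and>
        ((\<lambda>t. X t $ 1) has_real_derivative - (?x * ?c + ?y * ?s) * ?c) ?F \<and>
        ((\<lambda>t. X t $ 2) has_real_derivative - (?x * ?c + ?y * ?s) * ?s) ?F"
      using th real_derivative_cong_atLeast[OF 1 _ t] real_derivative_cong_atLeast[OF 2 _ t] X1 X2
      by simp
  qed
qed

section \<open>Uniqueness of solutions\<close>

lemma exponential_decay_unique:
  fixes \<theta> :: "real \<Rightarrow> real"
  assumes "\<And>t. t \<ge> 0 \<Longrightarrow> (\<theta> has_real_derivative - \<theta> t) (at t within {0..})" "t \<ge> 0"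
  shows "\<theta> t = \<theta> 0 * exp (- t)"
proof -
  \<comment> \<open>The integrating factor \<open>exp t\<close> makes the product constant.\<close>
  have "((\<lambda>t. \<theta> t * exp t) has_real_derivative 0) (at s within {0..})" if "s \<in> {0..}" for s
    using that by (auto intro!: derivative_eq_intros assms(1) simp: algebra_simps)
  then obtain c where c: "\<And>s. s \<ge> 0 \<Longrightarrow> \<theta> s * exp s = c"
    using has_field_derivative_zero_constant[of "{0::real..}" "\<lambda>t. \<theta> t * exp t"] by auto
  have "\<theta> t * exp t = \<theta> 0"
    using c[of t] c[of 0] \<open>t \<ge> 0\<close> by simp
  then show ?thesis
    by (simp add: exp_minus field_simps)
qed

text \<open>The squared distance of two solutions has derivative \<open>- 2 * (z1 t - w1 t)\<^sup>2\<close>, so it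
  cannot grow.\<close>

lemma rotated_system_unique:
  assumes z: "rotated_system \<theta> z1 z2" and w: "rotated_system \<theta> w1 w2"
    and init: "z1 0 = w1 0" "z2 0 = w2 0" and "t \<ge> 0"
  shows "z1 t = w1 t \<and> z2 t = w2 t"
proof -
  define E where "E = (\<lambda>t. (z1 t - w1 t)\<^sup>2 + (z2 t - w2 t)\<^sup>2)"
  have E: "(E has_real_derivative - 2 * (z1 s - w1 s)\<^sup>2) (at s within {0..})" if "s \<ge> 0" for s
  proof -
    have "(z1 has_real_derivative - z1 s - \<theta> s * z2 s) (at s within {0..})"
      "(z2 has_real_derivative \<theta> s * z1 s) (at s within {0..})"
      "(w1 has_real_derivative - w1 s - \<theta> s * w2 s) (at s within {0..})"
      "(w2 has_real_derivative \<theta> s * w1 s) (at s within {0..})"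
      using z w that unfolding rotated_system_def by auto
    note d = this
    show ?thesis
      unfolding E_def
      by (rule derivative_eq_intros d refl)+ (simp add: power2_eq_square algebra_simps)
  qed
  have "E t \<le> E 0"
  proof (rule DERIV_nonpos_imp_decreasing_open[OF \<open>t \<ge> 0\<close>])
    \<comment> \<open>A point x > 0 is interior to \<open>{0..}\<close>, so the derivative within
      the half-line is two-sided there.\<close>
    show "\<exists>y. (E has_real_derivative y) (at x) \<and> y \<le> 0" if "0 < x" "x < t" for x
      using E[of x] that by (auto simp: at_within_interior[of x "{0..}"])
    have "continuous_on {0..} E"
      using E by (auto intro!: DERIV_continuous_on)
    then show "continuous_on {0..t} E"
      by (rule continuous_on_subset) auto
  qed
  moreover have "E 0 = 0"
    by (simp add: E_def init)
  ultimately have "E t = 0"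
    unfolding E_def by (smt (verit) zero_le_power2)
  then show ?thesis
    by (simp add: E_def sum_power2_eq_zero_iff)
qed

subsection \<open>Closed-form solutions\<close>

text \<open>Along \<theta>' = - \<theta> the operator d/dt is - \<theta> d/d\<theta>. The product
  rule for \<theta> w gives the first equation, and the self-adjoint Bessel equation for w gives the
  second.\<close>

lemma bessel_solution:
  fixes \<theta>0 c1 c2 :: real
  defines "\<theta> \<equiv> \<lambda>t. \<theta>0 * exp (- t)"
  assumes "\<theta>0 \<noteq> 0"
  shows "rotated_system \<theta> (\<lambda>t. \<theta> t * (c1 * rJ (\<theta> t) + c2 * rY (\<theta> t)))
           (\<lambda>t. c1 * rdJ (\<theta> t) + c2 * rdY (\<theta> t))"
  unfolding rotated_system_def
proof (intro allI impI)
  fix t :: real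
  let ?F = "at t within {0..}"
  have nz: "\<theta> t \<noteq> 0"
    using assms by simp
  have th: "(\<theta> has_real_derivative - \<theta> t) ?F"
    unfolding \<theta>_def by (auto intro!: derivative_eq_intros)
  note d = DERIV_chain2[OF rJ_deriv[OF nz] th] DERIV_chain2[OF rY_deriv[OF nz] th]
    DERIV_chain2[OF rdJ_deriv th] DERIV_chain2[OF rdY_deriv[OF nz] th]
  have 1: "((\<lambda>t. \<theta> t * (c1 * rJ (\<theta> t) + c2 * rY (\<theta> t))) has_real_derivative
     - (\<theta> t * (c1 * rJ (\<theta> t) + c2 * rY (\<theta> t))) - \<theta> t * (c1 * rdJ (\<theta> t) + c2 * rdY (\<theta> t))) ?F"
    by (rule derivative_eq_intros d th refl)+ (use nz in \<open>simp add: field_simps\<close>)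
  have 2: "((\<lambda>t. c1 * rdJ (\<theta> t) + c2 * rdY (\<theta> t)) has_real_derivative
     \<theta> t * (\<theta> t * (c1 * rJ (\<theta> t) + c2 * rY (\<theta> t)))) ?F"
    by (rule derivative_eq_intros d refl)+ (simp add: algebra_simps)
  from th 1 2 show "(\<theta> has_real_derivative - \<theta> t) ?F \<and>
    ((\<lambda>t. \<theta> t * (c1 * rJ (\<theta> t) + c2 * rY (\<theta> t))) has_real_derivative
     - (\<theta> t * (c1 * rJ (\<theta> t) + c2 * rY (\<theta> t))) - \<theta> t * (c1 * rdJ (\<theta> t) + c2 * rdY (\<theta> t))) ?F \<and>
    ((\<lambda>t. c1 * rdJ (\<theta> t) + c2 * rdY (\<theta> t)) has_real_derivative
     \<theta> t * (\<theta> t * (c1 * rJ (\<theta> t) + c2 * rY (\<theta> t)))) ?F"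
    by blast
qed

text \<open>Serves to identify the existentially quantified derivatives in
  \<open>closed_form\<close>, also at the endpoint 0, which is a limit point of the
  half-line.\<close>

lemma real_derivative_unique_atLeast:
  fixes f :: "real \<Rightarrow> real"
  assumes "(f has_real_derivative a) (at t within {0..})"
    "(f has_real_derivative b) (at t within {0..})" "t \<ge> 0"
  shows "a = b"
proof (rule vector_derivative_unique_within)
  have "t islimpt {t..t+1}"
    by (simp add: islimpt_Icc)
  then have "t islimpt {0..}"
    by (rule islimpt_subset) (use \<open>t \<ge> 0\<close> in auto)
  then show "at t within {0..} \<noteq> bot"
    by (simp add: trivial_limit_within)
qed (use assms in \<open>auto simp: has_real_derivative_iff_has_vector_derivative\<close>)

lemma rotated_system_cong:
  assumes "rotated_system \<theta> z1 z2"
    and "\<And>t. t \<ge> 0 \<Longrightarrow> \<theta>' t = \<theta> t" "\<And>t. t \<ge> 0 \<Longrightarrow> w1 t = z1 t" "\<And>t. t \<ge> 0 \<Longrightarrow> w2 t = z2 t"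
  shows "rotated_system \<theta>' w1 w2"
  unfolding rotated_system_def
proof (intro allI impI)
  fix t :: real assume t: "t \<ge> 0"
  note * = real_derivative_cong_atLeast[OF _ _ t]
  have "(\<theta> has_real_derivative - \<theta> t) (at t within {0..})"
    "(z1 has_real_derivative - z1 t - \<theta> t * z2 t) (at t within {0..})"
    "(z2 has_real_derivative \<theta> t * z1 t) (at t within {0..})"
    using assms(1) t by (auto simp: rotated_system_def)
  from *[OF this(1) assms(2)] *[OF this(2) assms(3)] *[OF this(3) assms(4)]
  show "(\<theta>' has_real_derivative - \<theta>' t) (at t within {0..}) \<and>
      (w1 has_real_derivative - w1 t - \<theta>' t * w2 t) (at t within {0..}) \<and>
      (w2 has_real_derivative \<theta>' t * w1 t) (at t within {0..})"
    using assms t by simp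
qed

text \<open>The quotient defining z2 is explicit: the derivative of z1 plus z1 equals - \<theta>
  times the combination of \<open>rdJ\<close> and \<open>rdY\<close>, and \<theta>' = - \<theta> is
  nonzero.\<close>

lemma closed_form_iff:
  fixes \<theta>0 c1 c2 :: real
  assumes nz: "\<theta>0 \<noteq> 0"
    and C: "of_real c1 = (if \<theta>0 > 0 then C1 else C1 + 2 * \<i> * C2)" "of_real c2 = C2"
  shows "closed_form \<theta>0 C1 C2 \<theta> Z \<longleftrightarrow>
    (\<forall>t\<ge>0. \<theta> t = \<theta>0 * exp (- t)
       \<and> Z t $ 1 = \<theta> t * (c1 * rJ (\<theta> t) + c2 * rY (\<theta> t))
       \<and> Z t $ 2 = c1 * rdJ (\<theta> t) + c2 * rdY (\<theta> t))"
    (is "_ \<longleftrightarrow> ?R")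
proof -
  let ?e = "\<lambda>t. \<theta>0 * exp (- t)"
  have z1: "of_real a = of_real (?e t) *
        (C1 * bessel_J0 (of_real (?e t)) + C2 * bessel_Y0 (of_real (?e t)))
      \<longleftrightarrow> a = ?e t * (c1 * rJ (?e t) + c2 * rY (?e t))" for a t
  proof -
    \<comment> \<open>The angle keeps the sign of \<open>\<theta>0\<close>, so one choice of branch
      serves all times.\<close>
    have "of_real c1 = (if ?e t > 0 then C1 else C1 + 2 * \<i> * C2)"
      using C(1) by (simp add: zero_less_mult_iff)
    then have *: "C1 * bessel_J0 (of_real (?e t)) + C2 * bessel_Y0 (of_real (?e t))
        = of_real (c1 * rJ (?e t) + c2 * rY (?e t))"
      using bessel_combination_of_real[of "?e t" "of_real c1" C1 C2] nz C(2)[symmetric] by simp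
    show ?thesis
      unfolding * of_real_mult[symmetric] of_real_eq_iff ..
  qed
  \<comment> \<open>The formulas for the angle and z1 alone suffice here; nothing is yet assumed
    about the second component of \<open>Z\<close>.\<close>
  have sys: "rotated_system \<theta> (\<lambda>t. Z t $ 1) (\<lambda>t. c1 * rdJ (\<theta> t) + c2 * rdY (\<theta> t))"
    if "\<And>t. t \<ge> 0 \<Longrightarrow> \<theta> t = ?e t"
      "\<And>t. t \<ge> 0 \<Longrightarrow> Z t $ 1 = ?e t * (c1 * rJ (?e t) + c2 * rY (?e t))"
    by (rule rotated_system_cong[OF bessel_solution[OF nz, of c1 c2]]) (use that in auto)
  show ?thesis
  proof
    assume cf: "closed_form \<theta>0 C1 C2 \<theta> Z"
    have th: "\<theta> t = ?e t" if "t \<ge> 0" for t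
      using cf that by (simp add: closed_form_def)
    have zz: "Z t $ 1 = ?e t * (c1 * rJ (?e t) + c2 * rY (?e t))" if "t \<ge> 0" for t
      using cf that th[OF that] z1 unfolding closed_form_def by metis
    note s = sys[OF th zz]
    show ?R
    proof (intro allI impI)
      fix t :: real assume t: "t \<ge> 0"
      obtain z' th' where d: "((\<lambda>s. Z s $ 1) has_real_derivative z') (at t within {0..})"
        "(\<theta> has_real_derivative th') (at t within {0..})" "Z t $ 2 = (z' + Z t $ 1) / th'"
        using cf t unfolding closed_form_def by blast
      have "z' = - Z t $ 1 - \<theta> t * (c1 * rdJ (\<theta> t) + c2 * rdY (\<theta> t))" "th' = - \<theta> t"
        using s t d real_derivative_unique_atLeast unfolding rotated_system_def by blast+
      moreover have "\<theta> t \<noteq> 0"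
        using th[OF t] nz by simp
      ultimately show "\<theta> t = ?e t \<and> Z t $ 1 = \<theta> t * (c1 * rJ (\<theta> t) + c2 * rY (\<theta> t)) \<and>
          Z t $ 2 = c1 * rdJ (\<theta> t) + c2 * rdY (\<theta> t)"
        using d(3) th[OF t] zz[OF t] by simp
    qed
  next
    assume R: ?R
    have s: "rotated_system \<theta> (\<lambda>t. Z t $ 1) (\<lambda>t. c1 * rdJ (\<theta> t) + c2 * rdY (\<theta> t))"
      by (rule sys) (use R in auto)
    show "closed_form \<theta>0 C1 C2 \<theta> Z"
      unfolding closed_form_def
    proof (intro allI impI conjI)
      fix t :: real assume t: "t \<ge> 0"
      show th: "\<theta> t = ?e t"
        using R t by blast
      show "of_real (Z t $ 1) = of_real (\<theta> t) *
          (C1 * bessel_J0 (of_real (\<theta> t)) + C2 * bessel_Y0 (of_real (\<theta> t)))"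
        using R t z1 by (metis th)
      have "\<theta> t \<noteq> 0"
        using th nz by simp
      then have "Z t $ 2 = (- Z t $ 1 - \<theta> t * (c1 * rdJ (\<theta> t) + c2 * rdY (\<theta> t)) + Z t $ 1) / (- \<theta> t)"
        using R t by simp
      then show "\<exists>z1' \<theta>'. ((\<lambda>s. Z s $ 1) has_real_derivative z1') (at t within {0..})
          \<and> (\<theta> has_real_derivative \<theta>') (at t within {0..}) \<and> Z t $ 2 = (z1' + Z t $ 1) / \<theta>'"
        using s t unfolding rotated_system_def by blast
    qed
  qed
qed

lemma closed_form_rotated_system:
  assumes nz: "\<theta>0 \<noteq> 0"
    and C: "of_real c1 = (if \<theta>0 > 0 then C1 else C1 + 2 * \<i> * C2)" "of_real c2 = C2"
    and cf: "closed_form \<theta>0 C1 C2 \<theta> Z"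
  shows "rotated_system \<theta> (\<lambda>t. Z t $ 1) (\<lambda>t. Z t $ 2)"
  by (rule rotated_system_cong[OF bessel_solution[OF nz, of c1 c2]])
    (use cf closed_form_iff[OF nz C] in auto)

text \<open>Cramer's rule: the determinant is the Wronskian 2 / pi, whence the factor pi / 2 in the
  witnesses.\<close>

lemma bessel_constants_exist:
  obtains c1 c2 where "c1 * rJ x + c2 * rY x = a" "c1 * rdJ x + c2 * rdY x = b"
proof
  have w: "pi / 2 * (rJ x * rdY x - rdJ x * rY x) = 1"
    by (simp add: wronskian_real)
  have "(pi / 2 * (a * rdY x - b * rY x)) * rJ x + (pi / 2 * (b * rJ x - a * rdJ x)) * rY x
      = a * (pi / 2 * (rJ x * rdY x - rdJ x * rY x))"
    by (simp add: algebra_simps)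
  then show "(pi / 2 * (a * rdY x - b * rY x)) * rJ x + (pi / 2 * (b * rJ x - a * rdJ x)) * rY x = a"
    unfolding w by simp
  have "(pi / 2 * (a * rdY x - b * rY x)) * rdJ x + (pi / 2 * (b * rJ x - a * rdJ x)) * rdY x
      = b * (pi / 2 * (rJ x * rdY x - rdJ x * rY x))"
    by (simp add: algebra_simps)
  then show "(pi / 2 * (a * rdY x - b * rY x)) * rdJ x + (pi / 2 * (b * rJ x - a * rdJ x)) * rdY x = b"
    unfolding w by simp
qed

theorem mainTheorem2:
  fixes \<theta>0 :: real
  assumes "\<theta>0 \<noteq> 0"
  shows "(\<forall>X0 :: real^2. \<exists>C1 C2. admissible_constants \<theta>0 C1 C2 \<and>
           (\<forall>X \<theta> Z. (\<forall>t\<ge>0. X t = rotation (\<theta> t) *v Z t) \<longrightarrow>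
              (closed_loop (-1) X \<theta> \<and> X 0 = X0 \<and> \<theta> 0 = \<theta>0 \<longleftrightarrow> closed_form \<theta>0 C1 C2 \<theta> Z)))
       \<and> (\<forall>C1 C2. admissible_constants \<theta>0 C1 C2 \<longrightarrow>
           (\<exists>X \<theta> Z. (\<forall>t\<ge>0. X t = rotation (\<theta> t) *v Z t) \<and>
              closed_form \<theta>0 C1 C2 \<theta> Z \<and> closed_loop (-1) X \<theta> \<and> \<theta> 0 = \<theta>0))"
proof (intro conjI allI impI)
  fix X0 :: "real^2"
  define Z0 where "Z0 = rotation (- \<theta>0) *v X0"
  \<comment> \<open>Matching at t = 0, where z1 is \<open>\<theta>0\<close> times the Bessel
    combination; hence the division by \<open>\<theta>0\<close>.\<close>
  obtain c1 c2 where c: "c1 * rJ \<theta>0 + c2 * rY \<theta>0 = Z0 $ 1 / \<theta>0" "c1 * rdJ \<theta>0 + c2 * rdY \<theta>0 = Z0 $ 2"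
    by (rule bessel_constants_exist)
  \<comment> \<open>On the negative half-axis the subtraction offsets the branch term 2 i J_0
    contained in Y_0.\<close>
  define C1 where "C1 = (if \<theta>0 > 0 then of_real c1 else of_real c1 - 2 * \<i> * of_real c2)"
  define C2 :: complex where "C2 = of_real c2"
  have C: "of_real c1 = (if \<theta>0 > 0 then C1 else C1 + 2 * \<i> * C2)" "of_real c2 = C2"
    by (simp_all add: C1_def C2_def)
  show "\<exists>C1 C2. admissible_constants \<theta>0 C1 C2 \<and>
           (\<forall>X \<theta> Z. (\<forall>t\<ge>0. X t = rotation (\<theta> t) *v Z t) \<longrightarrow>
              (closed_loop (-1) X \<theta> \<and> X 0 = X0 \<and> \<theta> 0 = \<theta>0 \<longleftrightarrow> closed_form \<theta>0 C1 C2 \<theta> Z))"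
  proof (rule exI[of _ C1], rule exI[of _ C2], intro conjI allI impI)
    show "admissible_constants \<theta>0 C1 C2"
      by (simp add: admissible_constants_def C1_def C2_def)
    fix X :: "real \<Rightarrow> real^2" and \<theta> Z
    assume X: "\<forall>t\<ge>0. X t = rotation (\<theta> t) *v Z t"
    show "closed_loop (-1) X \<theta> \<and> X 0 = X0 \<and> \<theta> 0 = \<theta>0 \<longleftrightarrow> closed_form \<theta>0 C1 C2 \<theta> Z"
    proof
      assume cl: "closed_loop (-1) X \<theta> \<and> X 0 = X0 \<and> \<theta> 0 = \<theta>0"
      have rs: "rotated_system \<theta> (\<lambda>t. Z t $ 1) (\<lambda>t. Z t $ 2)"
        using cl closed_loop_iff_rotated_system[OF X] by blast
      have th: "\<theta> t = \<theta>0 * exp (- t)" if "t \<ge> 0" for t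
        using exponential_decay_unique[of \<theta> t] rs cl that unfolding rotated_system_def by auto
      have Z0: "Z 0 = Z0"
        using X cl unfolding Z0_def by (metis rotation_inverse(2) order_refl)
      have rs': "rotated_system \<theta> (\<lambda>t. \<theta> t * (c1 * rJ (\<theta> t) + c2 * rY (\<theta> t)))
          (\<lambda>t. c1 * rdJ (\<theta> t) + c2 * rdY (\<theta> t))"
        by (rule rotated_system_cong[OF bessel_solution[OF assms, of c1 c2]]) (simp_all add: th)
      \<comment> \<open>Both solutions start at \<open>Z0\<close> by the choice of \<open>c1\<close>
        and \<open>c2\<close>, so uniqueness carries the formulas to all t >= 0.\<close>
      have "Z t $ 1 = \<theta> t * (c1 * rJ (\<theta> t) + c2 * rY (\<theta> t)) \<and>
          Z t $ 2 = c1 * rdJ (\<theta> t) + c2 * rdY (\<theta> t)" if "t \<ge> 0" for t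
        by (rule rotated_system_unique[OF rs rs' _ _ that]) (use assms cl c Z0 in auto)
      then show "closed_form \<theta>0 C1 C2 \<theta> Z"
        unfolding closed_form_iff[OF assms C] using th by blast
    next
      assume cf: "closed_form \<theta>0 C1 C2 \<theta> Z"
      have 0: "\<theta> 0 = \<theta>0" "Z 0 $ 1 = \<theta>0 * (c1 * rJ \<theta>0 + c2 * rY \<theta>0)"
        "Z 0 $ 2 = c1 * rdJ \<theta>0 + c2 * rdY \<theta>0"
        using cf unfolding closed_form_iff[OF assms C] by force+
      then have "Z 0 = Z0"
        using assms by (simp add: c vec_eq_iff forall_2)
      then have "X 0 = X0"
        using X 0(1) by (simp add: Z0_def rotation_inverse)
      then show "closed_loop (-1) X \<theta> \<and> X 0 = X0 \<and> \<theta> 0 = \<theta>0"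
        using closed_form_rotated_system[OF assms C cf] closed_loop_iff_rotated_system[OF X] 0(1)
        by blast
    qed
  qed
next
  fix C1 C2
  assume adm: "admissible_constants \<theta>0 C1 C2"
  then have "(if \<theta>0 > 0 then C1 else C1 + 2 * \<i> * C2) \<in> \<real>" "C2 \<in> \<real>"
    by (auto simp: admissible_constants_def split: if_splits)
  then obtain c1 c2 :: real where
    C: "of_real c1 = (if \<theta>0 > 0 then C1 else C1 + 2 * \<i> * C2)" "of_real c2 = C2"
    by (metis Reals_cases)
  define \<theta> where "\<theta> = (\<lambda>t. \<theta>0 * exp (- t))"
  \<comment> \<open>The second component is written with \<open>rdJ\<close> and \<open>rdY\<close>;
    \<open>closed_form_iff\<close> shows that it is the required quotient.\<close>
  define Z :: "real \<Rightarrow> real^2" where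
    "Z = (\<lambda>t. vector [\<theta> t * (c1 * rJ (\<theta> t) + c2 * rY (\<theta> t)), c1 * rdJ (\<theta> t) + c2 * rdY (\<theta> t)])"
  define X where "X = (\<lambda>t. rotation (\<theta> t) *v Z t)"
  have cf: "closed_form \<theta>0 C1 C2 \<theta> Z"
    unfolding closed_form_iff[OF assms C] by (simp add: Z_def \<theta>_def)
  have X: "\<forall>t\<ge>0. X t = rotation (\<theta> t) *v Z t"
    by (simp add: X_def)
  have "closed_loop (-1) X \<theta>"
    using closed_form_rotated_system[OF assms C cf] closed_loop_iff_rotated_system[OF X] by blast
  moreover have "\<theta> 0 = \<theta>0"
    by (simp add: \<theta>_def)
  ultimately show "\<exists>X \<theta> Z. (\<forall>t\<ge>0. X t = rotation (\<theta> t) *v Z t) \<and>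
      closed_form \<theta>0 C1 C2 \<theta> Z \<and> closed_loop (-1) X \<theta> \<and> \<theta> 0 = \<theta>0"
    using X cf by blast
qed

end
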